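(* Let $X$ be a Banach space and let $V\subseteq S(\mathbb K)$ be a BK-space such that $e_n\in V$ for all $n\in\mathbb N$. The following statements are equivalent: i. $M_\Sigma(V,X)$ is a Banach space. ii. There exists $c\in(0,\infty)$ such that for each $f\in M_\Sigma(V,X)$ and each $v\in V$ with $\|v\|_V\le1$, $$\Big\|\sum_{n=1}^k v(n)f(n)\Big\|\le c\,\|f\|_{M_\Sigma(V,X)}\qquad\forall k\in\mathbb N.$$ Moreover, for $c\in(0,\infty)$, the condition in ii (with this $c$) is equivalent to $$\frac1c\|f\|_{M'(V,\Sigma c(X))}\le\|f\|_{M_\Sigma(V,X)}\le\|f\|_{M'(V,\Sigma c(X))}\qquad\forall f\in M_\Sigma(V,X).$$
   Context: $\mathbb K=\mathbb R$ or $\mathbb C$. $S(X)$ is the vector space of all sequences in $X$ (functions $\mathbb N\to X$); $e_n\in S(\mathbb K)$ is the $n$-th canonical sequence (1 at $n$, 0 elsewhere). A BK-space in $S(\mathbb K)$ is a vector subspace with a complete norm for which every coordinate map $v\mapsto v(n)$ is continuous. $\Sigma c(X)$ is the Banach space of sequences $s=\{x_n\}_n$ in $X$ such that $\sum_n x_n$ converges, with norm $\|s\|_{\Sigma c(X)}=\sup_n\|\sum_{k=1}^n x_k\|$. $M'(V,\Sigma c(X)):=\{f\in S(X): v\cdot f\in\Sigma c(X)\ \forall v\in V\}$, where $(v\cdot f)(n)=v(n)f(n)$, with norm $\|f\|_{M'(V,\Sigma c(X))}:=\sup\{\|v\cdot f\|_{\Sigma c(X)}:\|v\|_V\le1\}$.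 $M_\Sigma(V,X)$ is the same vector space as $M'(V,\Sigma c(X))$, equipped instead with the norm $\|f\|_{M_\Sigma(V,X)}:=\sup\{\|\sum_{n=1}^\infty v(n)f(n)\|:\|v\|_V\le1\}$. *)

theory Defs
  imports "HOL-Analysis.Analysis" "HOL-Library.Function_Algebras"
begin

text \<open>
  The scalar field is a type \<open>'k\<close> of class \<open>real_normed_field\<close>. By the theorem of Gelfand and
  Mazur, \<open>\<real>\<close> and \<open>\<complex>\<close> are, up to isometric isomorphism, the only such fields.

  Sequences are indexed by \<open>nat\<close> starting at \<open>0\<close>, so position \<open>n\<close> here corresponds to \<open>n + 1\<close> in
  the usual notation, and \<open>\<Sum>n\<le>k. s n\<close> is the partial sum of the first \<open>k + 1 \<ge> 1\<close> terms.
\<close>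

text \<open>The class \<open>banach\<close> only provides real scalars; \<open>smul\<close> is the action of \<open>'k\<close>.\<close>

locale banach_over = vector_space smul
  for smul :: "'k::real_normed_field \<Rightarrow> 'x::banach \<Rightarrow> 'x" +
  assumes scale_of_real: "smul (of_real r) x = r *\<^sub>R x"
    and norm_scale: "norm (smul a x) = norm a * norm x"

lemma banach_over_scaleR: "banach_over (scaleR :: real \<Rightarrow> 'x::banach \<Rightarrow> 'x)"
  by unfold_locales (auto simp: algebra_simps)

lemma banach_over_mult: "banach_over ((*) :: 'k::{real_normed_field,banach} \<Rightarrow> 'k \<Rightarrow> 'k)"
  by unfold_locales (auto simp: algebra_simps scaleR_conv_of_real norm_mult)

text \<open>
  \<open>Metric_space\<close> demands nonnegativity and symmetry on the whole type, whereas \<open>N\<close> is only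
  meaningful on \<open>E\<close>; hence the value \<open>0\<close> off \<open>E\<close>.
\<close>

definition norm_dist :: "'b::ab_group_add set \<Rightarrow> ('b \<Rightarrow> real) \<Rightarrow> 'b \<Rightarrow> 'b \<Rightarrow> real" where
  "norm_dist E N u v = (if u \<in> E \<and> v \<in> E then N (u - v) else 0)"

locale normed_subspace = vector_space smul
  for smul :: "'k::real_normed_field \<Rightarrow> 'b::ab_group_add \<Rightarrow> 'b" +
  fixes E :: "'b set" and N :: "'b \<Rightarrow> real"
  assumes subspace_E: "subspace E"
    and N_nonneg: "v \<in> E \<Longrightarrow> 0 \<le> N v"
    and N_eq_0_iff: "v \<in> E \<Longrightarrow> N v = 0 \<longleftrightarrow> v = 0"
    and N_scale: "v \<in> E \<Longrightarrow> N (smul a v) = norm a * N v"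
    and N_triangle: "u \<in> E \<Longrightarrow> v \<in> E \<Longrightarrow> N (u + v) \<le> N u + N v"
begin

lemma N_minus_commute:
  assumes "u \<in> E" "v \<in> E" shows "N (u - v) = N (v - u)"
proof -
  have "N (smul (- 1) (v - u)) = N (v - u)"
    using assms by (simp add: N_scale subspace_diff subspace_E del: scale_minus_left)
  then show ?thesis by simp
qed

sublocale Metric_space E "norm_dist E N"
proof
  show "0 \<le> norm_dist E N x y" for x y
    by (simp add: norm_dist_def N_nonneg subspace_diff subspace_E)
  show "norm_dist E N x y = norm_dist E N y x" for x y
    by (simp add: norm_dist_def N_minus_commute)
  show "norm_dist E N x y = 0 \<longleftrightarrow> x = y" if "x \<in> E" "y \<in> E" for x y
    using that by (simp add: norm_dist_def N_eq_0_iff subspace_diff subspace_E)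
  show "norm_dist E N x z \<le> norm_dist E N x y + norm_dist E N y z"
    if "x \<in> E" "y \<in> E" "z \<in> E" for x y z
    using that N_triangle[of "x - y" "y - z"]
    by (simp add: norm_dist_def subspace_diff subspace_E)
qed

end

locale banach_subspace = normed_subspace +
  assumes complete_E: "mcomplete"

definition seq_scale :: "('k \<Rightarrow> 'b \<Rightarrow> 'b) \<Rightarrow> 'k \<Rightarrow> (nat \<Rightarrow> 'b) \<Rightarrow> nat \<Rightarrow> 'b" where
  "seq_scale smul a f = (\<lambda>n. smul a (f n))"

lemma vector_space_seq_scale:
  assumes "vector_space smul" shows "vector_space (seq_scale smul)"
proof -
  interpret vector_space smul by fact
  show ?thesis
    by unfold_locales (auto simp: seq_scale_def fun_eq_iff scale_right_distrib scale_left_distrib)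
qed

locale bk_space = banach_subspace "seq_scale ((*) :: 'k \<Rightarrow> 'k \<Rightarrow> 'k)" V N
  for V :: "(nat \<Rightarrow> 'k::real_normed_field) set" and N :: "(nat \<Rightarrow> 'k) \<Rightarrow> real" +
  assumes continuous_coordinate: "continuous_map mtopology euclidean (\<lambda>v. v n)"

definition unit_seq :: "nat \<Rightarrow> nat \<Rightarrow> 'k::zero_neq_one" where
  "unit_seq n = (\<lambda>m. if m = n then 1 else 0)"

definition Sigma_c :: "(nat \<Rightarrow> 'x::real_normed_vector) set" where
  "Sigma_c = {s. summable s}"

definition norm_Sigma_c :: "(nat \<Rightarrow> 'x::real_normed_vector) \<Rightarrow> real" where
  "norm_Sigma_c s = (SUP n. norm (\<Sum>k\<le>n. s k))"

definition seq_mult :: "('k \<Rightarrow> 'x \<Rightarrow> 'x) \<Rightarrow> (nat \<Rightarrow> 'k) \<Rightarrow> (nat \<Rightarrow> 'x) \<Rightarrow> nat \<Rightarrow> 'x" where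
  "seq_mult smul v f = (\<lambda>n. smul (v n) (f n))"

definition M'_space ::
  "('k \<Rightarrow> 'x \<Rightarrow> 'x) \<Rightarrow> (nat \<Rightarrow> 'k) set \<Rightarrow> (nat \<Rightarrow> 'x) set \<Rightarrow> (nat \<Rightarrow> 'x) set" where
  "M'_space smul V F = {f. \<forall>v\<in>V. seq_mult smul v f \<in> F}"

text \<open>
  The two suprema below are taken in \<open>real\<close>. If \<open>V\<close> is a BK-space and \<open>f\<close> lies in
  \<open>M'_space smul V Sigma_c\<close>, both sets are bounded, by the closed graph theorem applied to
  \<open>v \<mapsto> v \<cdot> f\<close>.
\<close>

definition norm_M' ::
  "('k \<Rightarrow> 'x \<Rightarrow> 'x) \<Rightarrow> (nat \<Rightarrow> 'k) set \<Rightarrow> ((nat \<Rightarrow> 'k) \<Rightarrow> real) \<Rightarrow> ((nat \<Rightarrow> 'x) \<Rightarrow> real)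
    \<Rightarrow> (nat \<Rightarrow> 'x) \<Rightarrow> real" where
  "norm_M' smul V N NF f = (SUP v\<in>{v \<in> V. N v \<le> 1}. NF (seq_mult smul v f))"

definition M_Sigma ::
  "('k \<Rightarrow> 'x \<Rightarrow> 'x) \<Rightarrow> (nat \<Rightarrow> 'k) set \<Rightarrow> (nat \<Rightarrow> 'x::real_normed_vector) set" where
  "M_Sigma smul V = M'_space smul V Sigma_c"

definition norm_M_Sigma ::
  "('k \<Rightarrow> 'x \<Rightarrow> 'x) \<Rightarrow> (nat \<Rightarrow> 'k) set \<Rightarrow> ((nat \<Rightarrow> 'k) \<Rightarrow> real)
    \<Rightarrow> (nat \<Rightarrow> 'x::real_normed_vector) \<Rightarrow> real" where
  "norm_M_Sigma smul V N f = (SUP v\<in>{v \<in> V. N v \<le> 1}. norm (\<Sum>n. smul (v n) (f n)))"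

end

theory Submission
  imports Defs
begin

text \<open>
  Everything rests on uniform boundedness for pointwise bounded families of continuous seminorms.
  Applied on \<open>V\<close> to the partial sums \<open>v \<mapsto> \<parallel>\<Sum>n\<le>k. v n \<cdot> f n\<parallel>\<close>, it makes both
  multiplier norms finite. Applied on \<open>M_Sigma\<close>, if that is complete, to the same sums as
  functions of \<open>f\<close>, indexed by \<open>k\<close> and \<open>v\<close> in the unit ball, it gives the constant \<open>c\<close>; these
  seminorms are continuous because \<open>\<parallel>f n\<parallel> \<le> N (unit_seq n) * norm_M_Sigma f\<close>, so the open mapping
  theorem is not needed. Conversely, with such a \<open>c\<close>, a Cauchy sequence for the norm of \<open>M_Sigma\<close>
  has uniformly Cauchy partial sums, and its coordinatewise limit is its limit in norm.
\<close>

section \<open>Uniform boundedness for seminorms\<close>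

context normed_subspace
begin

text \<open>Rescaling \<open>v\<close> to norm exactly \<open>r\<close> by a real scalar reduces the
  estimate to the ball. This turns every bound on a small or unit ball into a bound proportional to
  \<open>N v\<close>; the vector 0 is separate because the scalar divides by
  \<open>N v\<close>.\<close>

lemma seminorm_le_scaled:
  assumes scale: "\<And>a v. v \<in> E \<Longrightarrow> q (smul a v) = norm a * q v"
    and pos: "0 < r"
    and ball: "\<And>v. v \<in> E \<Longrightarrow> N v \<le> r \<Longrightarrow> q v \<le> C"
    and v: "v \<in> E"
  shows "q v \<le> C / r * N v"
proof (cases "N v = 0")
  case True
  then have "v = 0" using v by (simp add: N_eq_0_iff)
  then have "q v = 0" using scale[of v 0] v by simp
  with True show ?thesis by simp
next
  case False
  then have Nv: "N v > 0" using N_nonneg[OF v] by simp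
  let ?a = "of_real (r / N v)"
  have "smul ?a v \<in> E" using v subspace_E subspace_scale by blast
  moreover have "norm (?a :: 'k) = r / N v" using Nv pos by (simp add: norm_divide)
  ultimately have "r / N v * q v \<le> C"
    using ball[of "smul ?a v"] scale[OF v, of ?a] N_scale[OF v, of ?a] Nv by simp
  then show ?thesis using Nv pos by (simp add: field_simps)
qed

end

text \<open>Baire's theorem for the sublevel sets \<open>A j\<close>: they are closed and cover
  \<open>E\<close>, so one contains a ball, which is then moved to the origin. Stating it for
  seminorms lets the same partial sums be treated as functions of \<open>v\<close> or of
  \<open>f\<close>.\<close>

theorem (in banach_subspace) uniform_boundedness:
  assumes add: "\<And>i u v. i \<in> I \<Longrightarrow> u \<in> E \<Longrightarrow> v \<in> E \<Longrightarrow> q i (u + v) \<le> q i u + q i v"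
    and scale: "\<And>i a v. i \<in> I \<Longrightarrow> v \<in> E \<Longrightarrow> q i (smul a v) = norm a * q i v"
    and continuous: "\<And>i. i \<in> I \<Longrightarrow> \<exists>C. \<forall>v\<in>E. q i v \<le> C * N v"
    and pointwise: "\<And>v. v \<in> E \<Longrightarrow> \<exists>C. \<forall>i\<in>I. q i v \<le> C"
  obtains C where "0 < C" "\<And>i v. i \<in> I \<Longrightarrow> v \<in> E \<Longrightarrow> q i v \<le> C * N v"
proof -
  define A where "A j = {v \<in> E. \<forall>i\<in>I. q i v \<le> real j}" for j :: nat
  have minus: "q i (u - v) \<le> q i u + q i v" if "i \<in> I" "u \<in> E" "v \<in> E" for i u v
  proof -
    have "smul (- 1) v \<in> E" using that(3) subspace_E subspace_scale by blast
    then show ?thesis using add[OF that(1,2), of "smul (- 1) v"] scale[OF that(1,3), of "- 1"] by simp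
  qed
  have closed: "closedin mtopology (A j)" for j
    unfolding closedin_metric
  proof (intro conjI allI impI)
    show "A j \<subseteq> E" by (auto simp: A_def)
    fix x assume x: "x \<in> E - A j"
    then obtain i where i: "i \<in> I" "q i x > real j" by (auto simp: A_def not_le)
    obtain C where C: "\<And>v. v \<in> E \<Longrightarrow> q i v \<le> C * N v" using continuous i(1) by blast
    \<comment> \<open>\<open>C\<close> may be zero or negative, while the radius below divides by
      the constant.\<close>
    define K where "K = max C 1"
    have K: "q i v \<le> K * N v" if "v \<in> E" for v
      using C[OF that] mult_right_mono[of C K "N v"] N_nonneg[OF that] by (simp add: K_def)
    have K0: "K > 0" by (simp add: K_def)
    \<comment> \<open>Moving \<open>x\<close> by less than \<open>r\<close> lowers
      \<open>q i\<close> by less than its excess over \<open>j\<close>, so the ball of radius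
      \<open>r\<close> around \<open>x\<close> misses \<open>A j\<close>.\<close>
    define r where "r = (q i x - real j) / K"
    have "r > 0" using i K0 by (simp add: r_def)
    moreover have "disjnt (A j) (mball x r)"
    proof -
      have False if y: "y \<in> A j" "y \<in> mball x r" for y
      proof -
        have yE: "y \<in> E" "x \<in> E" using y x by (auto simp: A_def)
        have xy: "x - y \<in> E" using yE subspace_diff subspace_E by blast
        have "N (x - y) < r" using y yE by (simp add: norm_dist_def)
        then have "K * N (x - y) < q i x - real j" using K0 by (simp add: r_def field_simps)
        moreover have "q i x \<le> q i (x - y) + q i y" using add[OF i(1) xy yE(1)] by simp
        moreover have "q i y \<le> real j" using y i by (auto simp: A_def)
        ultimately show False using K[OF xy] by simp
      qed
      then show ?thesis unfolding disjnt_iff by blast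
    qed
    ultimately show "\<exists>r>0. disjnt (A j) (mball x r)" by blast
  qed
  have "\<Union> (range A) = E"
  proof (intro equalityI subsetI)
    fix v assume v: "v \<in> E"
    then obtain C where "\<And>i. i \<in> I \<Longrightarrow> q i v \<le> C" using pointwise by blast
    then have "v \<in> A (nat \<lceil>C\<rceil>)" using v unfolding A_def
      by (auto intro: order_trans[OF _ real_nat_ceiling_ge])
    then show "v \<in> \<Union> (range A)" by blast
  qed (auto simp: A_def)
  moreover have "0 \<in> E" using subspace_E subspace_0 by blast
  \<comment> \<open>The union is the whole nonempty space, which is its own interior. By Baire, the
    closed sets \<open>A j\<close> cannot then all have empty interior.\<close>
  ultimately have "mtopology interior_of \<Union> (range A) \<noteq> {}"
    using interior_of_topspace[of mtopology] by auto
  then obtain j where "mtopology interior_of A j \<noteq> {}"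
    using metric_Baire_category_alt[OF complete_E, of "range A"] closed by auto
  then obtain x r where x: "x \<in> E" and r: "r > 0" "mcball x r \<subseteq> A j"
    by (auto simp: in_interior_of_mcball ex_in_conv[symmetric])
  have xA: "x \<in> A j" using x r by auto
  \<comment> \<open>Write \<open>v\<close> as \<open>(v + x) - x\<close>: both terms lie in
    \<open>A j\<close>, and each contributes at most \<open>j\<close>.\<close>
  have ball: "q i v \<le> 2 * real j" if i: "i \<in> I" and v: "v \<in> E" "N v \<le> r" for i v
  proof -
    have vx: "v + x \<in> E" using v x subspace_add subspace_E by blast
    have "norm_dist E N (v + x) x \<le> r" using v vx x by (simp add: norm_dist_def)
    then have "v + x \<in> mcball x r" using x vx by (simp add: commute)
    then have "v + x \<in> A j" using r by blast
    moreover have "q i v \<le> q i (v + x) + q i x" using minus[OF i vx x] by simp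
    ultimately show ?thesis using xA i by (fastforce simp: A_def)
  qed
  show thesis
  proof
    \<comment> \<open>The summand 1 keeps the constant positive when \<open>j = 0\<close>.\<close>
    show "0 < 2 * real j / r + 1" using r by (simp add: add_nonneg_pos)
    fix i v assume i: "i \<in> I" and v: "v \<in> E"
    have "q i v \<le> 2 * real j / r * N v"
      by (rule seminorm_le_scaled[where q = "q i"]) (use i v r ball scale in auto)
    also have "\<dots> \<le> (2 * real j / r + 1) * N v"
      using N_nonneg[OF v] by (intro mult_right_mono) auto
    finally show "q i v \<le> (2 * real j / r + 1) * N v" .
  qed
qed

lemma (in bk_space) coordinate_bounded:
  obtains C where "0 < C" "\<And>v. v \<in> V \<Longrightarrow> norm (v n) \<le> C * N v"
proof -
  have 0: "0 \<in> V" using subspace_E subspace_0 by blast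
  \<comment> \<open>Passing to the metric topology of the scalar field gives the epsilon-delta form,
    used at 0 with epsilon 1. The closed ball of radius \<open>d / 2\<close> then lies in the open
    ball of radius \<open>d\<close>.\<close>
  have "continuous_map mtopology Met_TC.mtopology (\<lambda>v. v n)"
    using continuous_coordinate by (metis mtopology_is_euclidean)
  then obtain d where d: "d > 0" "\<And>v. v \<in> V \<Longrightarrow> norm_dist V N 0 v < d \<Longrightarrow> dist (0::'k) (v n) < 1"
    using 0 unfolding metric_continuous_map[OF Met_TC.Metric_space_axioms]
    by (metis zero_fun_apply zero_less_one)
  have *: "norm (v n) \<le> 1" if v: "v \<in> V" "N v \<le> d / 2" for v
  proof -
    have "norm_dist V N 0 v = N v" using v 0 by (subst commute) (simp add: norm_dist_def)
    then show ?thesis using d(2)[OF v(1)] d(1) v(2) by simp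
  qed
  have "norm (v n) \<le> 1 / (d / 2) * N v" if "v \<in> V" for v
    by (rule seminorm_le_scaled[where q = "\<lambda>v. norm (v n)"])
      (use that * d(1) in \<open>auto simp: seq_scale_def norm_mult\<close>)
  with d(1) show thesis by (intro that[of "1 / (d / 2)"]) auto
qed

section \<open>Multipliers into convergent series\<close>

locale bk_multipliers = X: banach_over smul + V: bk_space V N
  for smul :: "'k::real_normed_field \<Rightarrow> 'x::banach \<Rightarrow> 'x"
    and V :: "(nat \<Rightarrow> 'k) set" and N :: "(nat \<Rightarrow> 'k) \<Rightarrow> real" +
  assumes unit_seq_mem: "unit_seq n \<in> V"
begin

abbreviation "M \<equiv> M_Sigma smul V"
abbreviation "norm_M \<equiv> norm_M_Sigma smul V N"
abbreviation partial_sum :: "(nat \<Rightarrow> 'k) \<Rightarrow> nat \<Rightarrow> (nat \<Rightarrow> 'x) \<Rightarrow> 'x" where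
  "partial_sum v k f \<equiv> (\<Sum>n\<le>k. smul (v n) (f n))"

section \<open>Linearity of the partial sums in each argument\<close>

lemma bounded_linear_smul: "bounded_linear (smul a)"
proof (rule bounded_linear_intro)
  show "smul a (r *\<^sub>R x) = r *\<^sub>R smul a x" for r x
    by (simp add: X.scale_of_real[symmetric] mult.commute)
  show "norm (smul a x) \<le> norm x * norm a" for x
    by (simp add: X.norm_scale)
qed (rule X.scale_right_distrib)

lemma M_iff: "f \<in> M \<longleftrightarrow> (\<forall>v\<in>V. summable (\<lambda>n. smul (v n) (f n)))"
  by (simp add: M_Sigma_def M'_space_def Sigma_c_def seq_mult_def)

lemma partial_sum_add_right: "partial_sum v k (f + g) = partial_sum v k f + partial_sum v k g"
  by (simp add: X.scale_right_distrib sum.distrib)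

lemma partial_sum_diff_right: "partial_sum v k (f - g) = partial_sum v k f - partial_sum v k g"
  by (simp add: X.scale_right_diff_distrib sum_subtractf)

lemma partial_sum_scale_right: "partial_sum v k (seq_scale smul a f) = smul a (partial_sum v k f)"
  by (simp add: seq_scale_def X.scale_sum_right mult.commute)

lemma partial_sum_add_left: "partial_sum (u + v) k f = partial_sum u k f + partial_sum v k f"
  by (simp add: X.scale_left_distrib sum.distrib)

lemma partial_sum_scale_left:
  "partial_sum (seq_scale (*) a v) k f = smul a (partial_sum v k f)"
  by (simp add: seq_scale_def X.scale_sum_right)

section \<open>Bounds for the series and finiteness of both multiplier norms\<close>

lemma partial_sum_tendsto:
  assumes "f \<in> M" "v \<in> V"
  shows "(\<lambda>k. partial_sum v k f) \<longlonglongrightarrow> (\<Sum>n. smul (v n) (f n))"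
  using assms by (intro summable_LIMSEQ') (auto simp: M_iff)

lemma norm_suminf_le:
  assumes "f \<in> M" "v \<in> V" "\<And>k. norm (partial_sum v k f) \<le> B"
  shows "norm (\<Sum>n. smul (v n) (f n)) \<le> B"
  using Lim_bounded[OF tendsto_norm[OF partial_sum_tendsto[OF assms(1,2)]]] assms(3) by blast

text \<open>Uniform boundedness on \<open>V\<close> for fixed \<open>f\<close>, with index
  \<open>k\<close>: a partial sum involves finitely many continuous coordinates, and convergence of
  the series bounds the partial sums at each \<open>v\<close>.\<close>

lemma partial_sums_bounded:
  assumes f: "f \<in> M"
  obtains C where "\<And>v k. v \<in> V \<Longrightarrow> norm (partial_sum v k f) \<le> C * N v"
    "\<And>v k. v \<in> V \<Longrightarrow> N v \<le> 1 \<Longrightarrow> norm (partial_sum v k f) \<le> C"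
proof -
  obtain C where C: "0 < C"
    "\<And>k v. k \<in> (UNIV :: nat set) \<Longrightarrow> v \<in> V \<Longrightarrow> norm (partial_sum v k f) \<le> C * N v"
  proof (rule V.uniform_boundedness[where I = UNIV and q = "\<lambda>k v. norm (partial_sum v k f)"])
    show "norm (partial_sum (u + v) k f) \<le> norm (partial_sum u k f) + norm (partial_sum v k f)" for k u v
      unfolding partial_sum_add_left by (rule norm_triangle_ineq)
    show "norm (partial_sum (seq_scale (*) a v) k f) = norm a * norm (partial_sum v k f)" for k a v
      unfolding partial_sum_scale_left by (rule X.norm_scale)
    show "\<exists>C. \<forall>v\<in>V. norm (partial_sum v k f) \<le> C * N v" for k
    proof -
      have "\<exists>c. \<forall>v\<in>V. norm (v n) \<le> c * N v" for n
        by (rule V.coordinate_bounded[of n]) blast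
      then obtain c where c: "\<And>n v. v \<in> V \<Longrightarrow> norm (v n) \<le> c n * N v"
        by metis
      \<comment> \<open>The constant may depend on \<open>k\<close>, since only continuity of each
        single partial sum is claimed here.\<close>
      have "norm (partial_sum v k f) \<le> (\<Sum>n\<le>k. c n * norm (f n)) * N v" if "v \<in> V" for v
        unfolding sum_distrib_right
      proof (rule order_trans[OF norm_sum], rule sum_mono)
        fix n
        show "norm (smul (v n) (f n)) \<le> c n * norm (f n) * N v"
          using mult_right_mono[OF c[OF that, of n] norm_ge_zero[of "f n"]]
          by (simp add: X.norm_scale mult_ac)
      qed
      then show ?thesis by blast
    qed
    show "\<exists>C. \<forall>k\<in>UNIV. norm (partial_sum v k f) \<le> C" if "v \<in> V" for v
      using convergent_imp_Bseq[OF convergentI[OF partial_sum_tendsto[OF f that]]]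
      by (auto simp: Bseq_def)
  qed blast
  have "norm (partial_sum v k f) \<le> C" if "v \<in> V" "N v \<le> 1" for v k
    using order_trans[OF C(2)[OF UNIV_I that(1)] mult_left_le[OF that(2)]] C(1) by simp
  with C(2) show thesis by (intro that) auto
qed

text \<open>A supremum in \<open>real\<close> dominates its members only when the set is bounded;
  this makes \<open>norm_M\<close> a genuine upper bound.\<close>

lemma bdd_above_norm_M:
  assumes f: "f \<in> M"
  shows "bdd_above ((\<lambda>v. norm (\<Sum>n. smul (v n) (f n))) ` {v \<in> V. N v \<le> 1})"
proof -
  obtain C where C: "\<And>v k. v \<in> V \<Longrightarrow> norm (partial_sum v k f) \<le> C * N v"
    "\<And>v k. v \<in> V \<Longrightarrow> N v \<le> 1 \<Longrightarrow> norm (partial_sum v k f) \<le> C"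
    by (rule partial_sums_bounded[OF f], rule that)
  have "norm (\<Sum>n. smul (v n) (f n)) \<le> C" if "v \<in> V" "N v \<le> 1" for v
    using C(2) that by (intro norm_suminf_le[OF f])
  then show ?thesis by (auto intro!: bdd_aboveI2)
qed

lemma unit_ball_nonempty: "{v \<in> V. N v \<le> 1} \<noteq> {}"
  using V.subspace_0[OF V.subspace_E] V.N_eq_0_iff[of 0] by auto

lemma norm_M_leI:
  assumes "\<And>v. v \<in> V \<Longrightarrow> N v \<le> 1 \<Longrightarrow> norm (\<Sum>n. smul (v n) (f n)) \<le> B"
  shows "norm_M f \<le> B"
  unfolding norm_M_Sigma_def using unit_ball_nonempty assms by (intro cSUP_least) auto

lemma norm_suminf_le_norm_M:
  assumes "f \<in> M" "v \<in> V" "N v \<le> 1"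
  shows "norm (\<Sum>n. smul (v n) (f n)) \<le> norm_M f"
  unfolding norm_M_Sigma_def using assms bdd_above_norm_M by (intro cSUP_upper) auto

lemma norm_Sigma_c_seq_mult_le_iff:
  assumes f: "f \<in> M" and v: "v \<in> V"
  shows "norm_Sigma_c (seq_mult smul v f) \<le> B \<longleftrightarrow> (\<forall>k. norm (partial_sum v k f) \<le> B)"
proof -
  obtain C where C: "\<And>v k. v \<in> V \<Longrightarrow> norm (partial_sum v k f) \<le> C * N v"
    "\<And>v k. v \<in> V \<Longrightarrow> N v \<le> 1 \<Longrightarrow> norm (partial_sum v k f) \<le> C"
    by (rule partial_sums_bounded[OF f], rule that)
  have "bdd_above (range (\<lambda>k. norm (partial_sum v k f)))"
    by (rule bdd_aboveI2[OF C(1)[OF v]])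
  then show ?thesis
    unfolding norm_Sigma_c_def seq_mult_def by (subst cSUP_le_iff) auto
qed

text \<open>Both nested suprema run over bounded sets, so each unfolds into a pointwise estimate.
  Hence \<open>norm_M'\<close> is the least common bound of all partial sums over the unit ball,
  which links the uniform estimate to a comparison of norms.\<close>

lemma norm_M'_le_iff:
  assumes f: "f \<in> M"
  shows "norm_M' smul V N norm_Sigma_c f \<le> B \<longleftrightarrow>
    (\<forall>v\<in>V. N v \<le> 1 \<longrightarrow> (\<forall>k. norm (partial_sum v k f) \<le> B))"
proof -
  obtain C where C: "\<And>v k. v \<in> V \<Longrightarrow> norm (partial_sum v k f) \<le> C * N v"
    "\<And>v k. v \<in> V \<Longrightarrow> N v \<le> 1 \<Longrightarrow> norm (partial_sum v k f) \<le> C"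
    by (rule partial_sums_bounded[OF f], rule that)
  have "norm_Sigma_c (seq_mult smul v f) \<le> C" if "v \<in> V" "N v \<le> 1" for v
    using C(2) that by (simp add: norm_Sigma_c_seq_mult_le_iff[OF f])
  then have "bdd_above ((\<lambda>v. norm_Sigma_c (seq_mult smul v f)) ` {v \<in> V. N v \<le> 1})"
    by (auto intro!: bdd_aboveI2)
  then show ?thesis
    unfolding norm_M'_def using unit_ball_nonempty f
    by (subst cSUP_le_iff) (auto simp: norm_Sigma_c_seq_mult_le_iff)
qed

lemma norm_M_le_norm_M':
  assumes f: "f \<in> M"
  shows "norm_M f \<le> norm_M' smul V N norm_Sigma_c f"
  using norm_M'_le_iff[OF f, of "norm_M' smul V N norm_Sigma_c f"]
  by (intro norm_M_leI norm_suminf_le[OF f]) auto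

section \<open>The normed space of multipliers with the norm \<open>norm_M\<close>\<close>

lemma coordinate_le_norm_M:
  assumes f: "f \<in> M"
  shows "norm (f n) \<le> norm_M f * N (unit_seq n)"
proof -
  have scale: "norm (\<Sum>n. smul (seq_scale (*) a v n) (f n)) = norm a * norm (\<Sum>n. smul (v n) (f n))"
    if "v \<in> V" for a v
  proof -
    have "(\<Sum>n. smul a (smul (v n) (f n))) = smul a (\<Sum>n. smul (v n) (f n))"
      using f that by (intro bounded_linear.suminf[OF bounded_linear_smul, symmetric]) (auto simp: M_iff)
    then show ?thesis by (simp add: seq_scale_def X.norm_scale)
  qed
  \<comment> \<open>The unit sequence picks out \<open>f n\<close>, but its norm may exceed 1, so
    the bound on the unit ball is first extended by homogeneity.\<close>
  have "norm (\<Sum>m. smul (unit_seq n m) (f m)) \<le> norm_M f / 1 * N (unit_seq n)"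
    by (rule V.seminorm_le_scaled[where q = "\<lambda>v. norm (\<Sum>m. smul (v m) (f m))"])
      (use f scale unit_seq_mem norm_suminf_le_norm_M in auto)
  moreover have "(\<Sum>m. smul (unit_seq n m) (f m)) = f n"
    by (subst suminf_finite[of "{n}"]) (auto simp: unit_seq_def)
  ultimately show ?thesis by simp
qed

sublocale M: normed_subspace "seq_scale smul" M norm_M
proof -
  interpret vector_space "seq_scale smul"
    by (rule vector_space_seq_scale) (rule X.vector_space_axioms)
  have summable: "summable (\<lambda>n. smul (v n) (f n))" if "f \<in> M" "v \<in> V" for f v
    using that by (simp add: M_iff)
  have scale_sums: "(\<lambda>n. smul (v n) (seq_scale smul a f n)) sums smul a (\<Sum>n. smul (v n) (f n))"
    if "f \<in> M" "v \<in> V" for a f v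
    using bounded_linear.sums[OF bounded_linear_smul summable_sums[OF summable[OF that]], of a]
    by (simp add: seq_scale_def mult.commute)
  have nonneg: "0 \<le> norm_M f" if f: "f \<in> M" for f
    using unit_ball_nonempty norm_suminf_le_norm_M[OF f] by (blast intro: order_trans norm_ge_zero)
  have scale_le: "norm_M (seq_scale smul a f) \<le> norm a * norm_M f" if f: "f \<in> M" for a f
    using norm_suminf_le_norm_M[OF f]
    by (intro norm_M_leI) (simp add: scale_sums[OF f, THEN sums_unique, symmetric] X.norm_scale mult_left_mono)
  have subspace: "subspace M"
    unfolding subspace_def
    using scale_sums[THEN sums_summable] by (auto simp: M_iff X.scale_right_distrib summable_add)
  show "normed_subspace (seq_scale smul) M norm_M"
  proof
    fix f g a
    show "subspace M" by fact
    assume f: "f \<in> M"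
    show "0 \<le> norm_M f" by (rule nonneg[OF f])
    show "norm_M f = 0 \<longleftrightarrow> f = 0"
    proof
      assume "norm_M f = 0"
      \<comment> \<open>Definiteness: every coordinate is controlled by the norm.\<close>
      then show "f = 0" using coordinate_le_norm_M[OF f] by (auto simp: fun_eq_iff)
    next
      assume "f = 0"
      then have "norm_M f \<le> 0" by (intro norm_M_leI) simp
      with nonneg[OF f] show "norm_M f = 0" by simp
    qed
    show "norm_M (seq_scale smul a f) = norm a * norm_M f"
    proof (cases "a = 0")
      case True
      have "norm_M (seq_scale smul a f) \<le> 0" using scale_le[OF f, of a] True by simp
      then show ?thesis using True nonneg[OF subspace_scale[OF subspace f], of a] by simp
    next
      case False
      \<comment> \<open>Undoing the scaling by \<open>inverse a\<close> turns the upper estimate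
        \<open>scale_le\<close> into the matching lower one.\<close>
      have "norm_M (seq_scale smul (inverse a) (seq_scale smul a f)) \<le> norm (inverse a) * norm_M (seq_scale smul a f)"
        by (intro scale_le subspace_scale subspace f)
      then have "norm a * norm_M f \<le> norm_M (seq_scale smul a f)"
        using False by (simp add: norm_divide norm_inverse field_simps)
      with scale_le[OF f, of a] show ?thesis by simp
    qed
    assume g: "g \<in> M"
    show "norm_M (f + g) \<le> norm_M f + norm_M g"
    proof (rule norm_M_leI)
      fix v assume v: "v \<in> V" "N v \<le> 1"
      have "(\<Sum>n. smul (v n) ((f + g) n)) = (\<Sum>n. smul (v n) (f n)) + (\<Sum>n. smul (v n) (g n))"
        using suminf_add[OF summable[OF f v(1)] summable[OF g v(1)]] by (simp add: X.scale_right_distrib)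
      then show "norm (\<Sum>n. smul (v n) ((f + g) n)) \<le> norm_M f + norm_M g"
        by (simp only: norm_triangle_mono norm_suminf_le_norm_M f g v)
    qed
  qed
qed

section \<open>Completeness and uniform bounds on the partial sums\<close>

lemma complete_imp_partial_sums_uniformly_bounded:
  assumes "banach_subspace (seq_scale smul) M norm_M"
  obtains c where "0 < c"
    "\<And>f v k. f \<in> M \<Longrightarrow> v \<in> V \<Longrightarrow> N v \<le> 1 \<Longrightarrow> norm (partial_sum v k f) \<le> c * norm_M f"
proof -
  interpret B: banach_subspace "seq_scale smul" M norm_M by fact
  obtain c where c: "0 < c"
    "\<And>i f. i \<in> {v \<in> V. N v \<le> 1} \<times> (UNIV :: nat set) \<Longrightarrow> f \<in> M \<Longrightarrow>
       norm (partial_sum (fst i) (snd i) f) \<le> c * norm_M f"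
  proof (rule B.uniform_boundedness[where I = "{v \<in> V. N v \<le> 1} \<times> UNIV"
        and q = "\<lambda>i f. norm (partial_sum (fst i) (snd i) f)"])
    fix i :: "(nat \<Rightarrow> 'k) \<times> nat" and f g a
    show "norm (partial_sum (fst i) (snd i) (f + g))
        \<le> norm (partial_sum (fst i) (snd i) f) + norm (partial_sum (fst i) (snd i) g)"
      unfolding partial_sum_add_right by (rule norm_triangle_ineq)
    show "norm (partial_sum (fst i) (snd i) (seq_scale smul a f))
        = norm a * norm (partial_sum (fst i) (snd i) f)"
      unfolding partial_sum_scale_right by (rule X.norm_scale)
    \<comment> \<open>For one fixed pair of \<open>v\<close> and \<open>k\<close>, the coordinate
      estimates add up to a continuity constant, which may depend on the pair.\<close>
    have "norm (partial_sum (fst i) (snd i) f)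
        \<le> (\<Sum>n\<le>snd i. norm (fst i n) * N (unit_seq n)) * norm_M f" if "f \<in> M" for f
      unfolding sum_distrib_right
    proof (rule order_trans[OF norm_sum], rule sum_mono)
      fix n
      show "norm (smul (fst i n) (f n)) \<le> norm (fst i n) * N (unit_seq n) * norm_M f"
        using mult_left_mono[OF coordinate_le_norm_M[OF that, of n], of "norm (fst i n)"]
        by (simp add: X.norm_scale mult.commute mult.left_commute)
    qed
    then show "\<exists>C. \<forall>f\<in>M. norm (partial_sum (fst i) (snd i) f) \<le> C * norm_M f" by blast
  next
    fix f assume f: "f \<in> M"
    \<comment> \<open>The choice \<open>B = norm_M'\<close> makes the left side of
      \<open>norm_M'_le_iff\<close> trivial. This bound depends on \<open>f\<close>; uniform
      boundedness replaces it by a multiple of \<open>norm_M f\<close>.\<close>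
    have "\<forall>v\<in>V. N v \<le> 1 \<longrightarrow> (\<forall>k. norm (partial_sum v k f) \<le> norm_M' smul V N norm_Sigma_c f)"
      using norm_M'_le_iff[OF f] by blast
    then show "\<exists>C. \<forall>i\<in>{v \<in> V. N v \<le> 1} \<times> UNIV. norm (partial_sum (fst i) (snd i) f) \<le> C"
      by (intro exI[of _ "norm_M' smul V N norm_Sigma_c f"]) auto
  qed blast
  show thesis
  proof
    show "0 < c" by fact
    show "norm (partial_sum v k f) \<le> c * norm_M f" if "f \<in> M" "v \<in> V" "N v \<le> 1" for f v k
      using c(2)[of "(v, k)" f] that by simp
  qed
qed

text \<open>Bounding all partial sums, and not only the full series, makes the coordinatewise limit
  of a Cauchy sequence a limit uniform in \<open>k\<close>. This permits the interchange of limits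
  that puts it in \<open>M\<close>.\<close>

lemma complete_if_partial_sums_uniformly_bounded:
  assumes c: "0 < c"
    and bound: "\<And>f v k. f \<in> M \<Longrightarrow> v \<in> V \<Longrightarrow> N v \<le> 1 \<Longrightarrow> norm (partial_sum v k f) \<le> c * norm_M f"
  shows "banach_subspace (seq_scale smul) M norm_M"
proof
  \<comment> \<open>Membership of the limit in \<open>M\<close> is tested against every
    \<open>v\<close> in \<open>V\<close>, so the bound must leave the unit ball.\<close>
  have bound': "norm (partial_sum v k f) \<le> c * norm_M f * N v" if "f \<in> M" "v \<in> V" for f v k
  proof -
    have "norm (partial_sum v k f) \<le> c * norm_M f / 1 * N v"
      by (rule V.seminorm_le_scaled[where q = "\<lambda>v. norm (partial_sum v k f)"])
        (use that bound in \<open>auto simp: partial_sum_scale_left X.norm_scale simp del: mult_1\<close>)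
    then show ?thesis by simp
  qed
  show "M.mcomplete"
    unfolding M.mcomplete_def
  proof (intro allI impI)
    fix F assume F: "M.MCauchy F"
    then have FM: "F j \<in> M" for j by (auto simp: M.MCauchy_def)
    have diffM: "F i - F j \<in> M" for i j using FM M.subspace_diff M.subspace_E by blast
    have Cauchy: "\<exists>J. \<forall>i\<ge>J. \<forall>j\<ge>J. norm_M (F i - F j) < e" if "e > 0" for e
      using F that FM by (fastforce simp: M.MCauchy_def norm_dist_def)
    have "convergent (\<lambda>j. F j n)" for n
    proof (rule Cauchy_convergent, rule metric_CauchyI)
      fix e :: real assume e: "e > 0"
      \<comment> \<open>The summand 1 gives a positive divisor that still dominates the norm of the
        unit sequence.\<close>
      define K where "K = N (unit_seq n) + 1"
      have K: "K > 0" using V.N_nonneg[OF unit_seq_mem[of n]] by (simp add: K_def)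
      obtain J where J: "\<forall>i\<ge>J. \<forall>j\<ge>J. norm_M (F i - F j) < e / K"
        using Cauchy[of "e / K"] e K by auto
      have "dist (F i n) (F j n) < e" if "i \<ge> J" "j \<ge> J" for i j
      proof -
        have "dist (F i n) (F j n) \<le> norm_M (F i - F j) * N (unit_seq n)"
          using coordinate_le_norm_M[OF diffM[of i j], of n] by (simp add: dist_norm)
        also have "\<dots> \<le> norm_M (F i - F j) * K"
          using M.N_nonneg[OF diffM[of i j]] by (intro mult_left_mono) (auto simp: K_def)
        also have "\<dots> < e" using J that K by (auto simp: field_simps)
        finally show ?thesis .
      qed
      then show "\<exists>J. \<forall>i\<ge>J. \<forall>j\<ge>J. dist (F i n) (F j n) < e" by blast
    qed
    then obtain f where f: "\<And>n. (\<lambda>j. F j n) \<longlonglongrightarrow> f n"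
      unfolding convergent_def by metis
    have lim: "(\<lambda>i. partial_sum v k (F i)) \<longlonglongrightarrow> partial_sum v k f" for v k
      by (intro tendsto_sum bounded_linear.tendsto[OF bounded_linear_smul] f)
    \<comment> \<open>Fix \<open>j\<close> and let \<open>i\<close> tend to infinity in the Cauchy
      estimate. The threshold \<open>e / c\<close> cancels the factor \<open>c\<close> of
      \<open>bound'\<close>, and the resulting \<open>J\<close> serves all \<open>v\<close> and
      \<open>k\<close>.\<close>
    have close: "\<exists>J. \<forall>j\<ge>J. \<forall>v\<in>V. \<forall>k. norm (partial_sum v k (F j) - partial_sum v k f) \<le> e * N v"
      if e: "e > 0" for e
    proof -
      obtain J where J: "\<forall>i\<ge>J. \<forall>j\<ge>J. norm_M (F i - F j) < e / c"
        using Cauchy[of "e / c"] e c by auto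
      have "norm (partial_sum v k (F j) - partial_sum v k f) \<le> e * N v" if j: "j \<ge> J" and v: "v \<in> V" for j v k
      proof (rule Lim_bounded[of _ _ J])
        show "(\<lambda>i. norm (partial_sum v k (F j) - partial_sum v k (F i)))
            \<longlonglongrightarrow> norm (partial_sum v k (F j) - partial_sum v k f)"
          by (intro tendsto_intros lim)
        show "\<forall>i\<ge>J. norm (partial_sum v k (F j) - partial_sum v k (F i)) \<le> e * N v"
        proof (intro allI impI)
          fix i assume i: "i \<ge> J"
          have "norm (partial_sum v k (F j) - partial_sum v k (F i)) \<le> c * norm_M (F j - F i) * N v"
            unfolding partial_sum_diff_right[symmetric] by (rule bound'[OF diffM v])
          also have "\<dots> \<le> e * N v"
            using J i j c V.N_nonneg[OF v] by (intro mult_right_mono) (auto simp: field_simps less_imp_le)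
          finally show "norm (partial_sum v k (F j) - partial_sum v k (F i)) \<le> e * N v" .
        qed
      qed
      then show ?thesis by blast
    qed
    have fM: "f \<in> M"
      unfolding M_iff
    proof
      fix v assume v: "v \<in> V"
      \<comment> \<open>An epsilon/3 argument: the partial sums for \<open>f\<close> are uniformly
        close in \<open>k\<close> to those for one \<open>F j\<close>, which converge. Since
        \<open>N v < K\<close>, the error with \<open>e / (3 * K)\<close> stays strictly below
        \<open>e / 3\<close>.\<close>
      have "Cauchy (\<lambda>k. partial_sum v k f)"
      proof (rule metric_CauchyI)
        fix e :: real assume e: "e > 0"
        define K where "K = N v + 1"
        have K: "K > 0" using V.N_nonneg[OF v] by (simp add: K_def)
        obtain j where "\<forall>k. norm (partial_sum v k (F j) - partial_sum v k f) \<le> e / (3 * K) * N v"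
          using close[of "e / (3 * K)"] e K v by auto
        moreover have "e / (3 * K) * N v < e / 3"
          using e K by (simp add: K_def field_simps)
        ultimately have j: "dist (partial_sum v k (F j)) (partial_sum v k f) < e / 3" for k
          unfolding dist_norm by (meson le_less_trans)
        have "Cauchy (\<lambda>k. partial_sum v k (F j))"
          using partial_sum_tendsto[OF FM v] by (rule LIMSEQ_imp_Cauchy)
        then obtain K0 where K0: "\<forall>m\<ge>K0. \<forall>n\<ge>K0. dist (partial_sum v m (F j)) (partial_sum v n (F j)) < e / 3"
          using e by (auto dest: metric_CauchyD[of _ "e / 3"])
        have "dist (partial_sum v m f) (partial_sum v n f) < e" if "m \<ge> K0" "n \<ge> K0" for m n
        proof -
          have "dist (partial_sum v m (F j)) (partial_sum v n (F j)) < e / 3" using K0 that by blast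
          then show ?thesis
            by (rule dist_triangle_third[OF j[of m, unfolded dist_commute[of "partial_sum v m (F j)"]] _ j[of n]])
        qed
        then show "\<exists>K0. \<forall>m\<ge>K0. \<forall>n\<ge>K0. dist (partial_sum v m f) (partial_sum v n f) < e" by blast
      qed
      then have "convergent (\<lambda>k. partial_sum v k f)" by (rule Cauchy_convergent)
      then show "summable (\<lambda>n. smul (v n) (f n))" by (simp add: summable_iff_convergent')
    qed
    have "\<exists>J. \<forall>j\<ge>J. norm_dist M norm_M (F j) f < e" if e: "e > 0" for e
    proof -
      \<comment> \<open>Half of \<open>e\<close> is used because a supremum only inherits a weak
        inequality.\<close>
      obtain J where J: "\<And>j v k. j \<ge> J \<Longrightarrow> v \<in> V \<Longrightarrow>
          norm (partial_sum v k (F j) - partial_sum v k f) \<le> e / 2 * N v"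
        using close[of "e / 2"] e by auto
      have "norm_dist M norm_M (F j) f < e" if j: "j \<ge> J" for j
      proof -
        have dM: "F j - f \<in> M" using FM fM M.subspace_diff M.subspace_E by blast
        have "norm_M (F j - f) \<le> e / 2"
        proof (intro norm_M_leI norm_suminf_le[OF dM])
          fix v k assume v: "v \<in> V" "N v \<le> 1"
          have "norm (partial_sum v k (F j - f)) \<le> e / 2 * N v"
            unfolding partial_sum_diff_right by (rule J[OF j v(1)])
          also have "\<dots> \<le> e / 2" using e v(2) by (intro mult_left_le) auto
          finally show "norm (partial_sum v k (F j - f)) \<le> e / 2" .
        qed auto
        then show ?thesis using e FM fM by (simp add: norm_dist_def)
      qed
      then show ?thesis by blast
    qed
    then have "limitin M.mtopology F f sequentially"
      unfolding M.limitin_metric eventually_sequentially using FM fM by auto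
    then show "\<exists>f. limitin M.mtopology F f sequentially" by blast
  qed
qed

text \<open>Taking \<open>B = c * norm_M f\<close> in \<open>norm_M'_le_iff\<close> gives the left
  inequality for each \<open>f\<close>; the right one always holds, as the norm of a series is at
  most the supremum over its partial sums.\<close>

lemma partial_sums_bound_iff_norm_equivalence:
  assumes c: "0 < c"
  shows "(\<forall>f\<in>M. \<forall>v\<in>V. N v \<le> 1 \<longrightarrow> (\<forall>k. norm (partial_sum v k f) \<le> c * norm_M f)) \<longleftrightarrow>
    (\<forall>f\<in>M. 1 / c * norm_M' smul V N norm_Sigma_c f \<le> norm_M f
      \<and> norm_M f \<le> norm_M' smul V N norm_Sigma_c f)"
proof -
  have "1 / c * norm_M' smul V N norm_Sigma_c f \<le> norm_M f \<longleftrightarrow>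
      (\<forall>v\<in>V. N v \<le> 1 \<longrightarrow> (\<forall>k. norm (partial_sum v k f) \<le> c * norm_M f))" if "f \<in> M" for f
    unfolding norm_M'_le_iff[OF that, symmetric] using c by (simp add: field_simps)
  then show ?thesis using norm_M_le_norm_M' by simp
qed

end

theorem lemma10p2:
  fixes smul :: "'k::real_normed_field \<Rightarrow> 'x::banach \<Rightarrow> 'x"
    and V :: "(nat \<Rightarrow> 'k) set"
    and N :: "(nat \<Rightarrow> 'k) \<Rightarrow> real"
  assumes "banach_over smul"
    and "bk_space V N"
    and "\<And>n. unit_seq n \<in> V"
  shows "(banach_subspace (seq_scale smul) (M_Sigma smul V) (norm_M_Sigma smul V N)
      \<longleftrightarrow> (\<exists>c>0. \<forall>f\<in>M_Sigma smul V. \<forall>v\<in>V. N v \<le> 1 \<longrightarrow>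
             (\<forall>k. norm (\<Sum>n\<le>k. smul (v n) (f n)) \<le> c * norm_M_Sigma smul V N f)))
    \<and> (\<forall>c>0.
        (\<forall>f\<in>M_Sigma smul V. \<forall>v\<in>V. N v \<le> 1 \<longrightarrow>
             (\<forall>k. norm (\<Sum>n\<le>k. smul (v n) (f n)) \<le> c * norm_M_Sigma smul V N f))
        \<longleftrightarrow> (\<forall>f\<in>M_Sigma smul V.
             1 / c * norm_M' smul V N norm_Sigma_c f \<le> norm_M_Sigma smul V N f
           \<and> norm_M_Sigma smul V N f \<le> norm_M' smul V N norm_Sigma_c f))"
proof -
  interpret bk_multipliers smul V N
    using assms by (intro bk_multipliers.intro bk_multipliers_axioms.intro)
  show ?thesis
  proof (intro conjI allI impI)
    show "banach_subspace (seq_scale smul) M norm_M \<longleftrightarrow>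
        (\<exists>c>0. \<forall>f\<in>M. \<forall>v\<in>V. N v \<le> 1 \<longrightarrow> (\<forall>k. norm (partial_sum v k f) \<le> c * norm_M f))"
    proof
      assume complete: "banach_subspace (seq_scale smul) M norm_M"
      obtain c where "0 < c"
        "\<And>f v k. f \<in> M \<Longrightarrow> v \<in> V \<Longrightarrow> N v \<le> 1 \<Longrightarrow> norm (partial_sum v k f) \<le> c * norm_M f"
        by (rule complete_imp_partial_sums_uniformly_bounded[OF complete], rule that)
      then show "\<exists>c>0. \<forall>f\<in>M. \<forall>v\<in>V. N v \<le> 1 \<longrightarrow> (\<forall>k. norm (partial_sum v k f) \<le> c * norm_M f)"
        by blast
    next
      assume "\<exists>c>0. \<forall>f\<in>M. \<forall>v\<in>V. N v \<le> 1 \<longrightarrow> (\<forall>k. norm (partial_sum v k f) \<le> c * norm_M f)"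
      then obtain c where "0 < c"
        "\<forall>f\<in>M. \<forall>v\<in>V. N v \<le> 1 \<longrightarrow> (\<forall>k. norm (partial_sum v k f) \<le> c * norm_M f)" by blast
      then show "banach_subspace (seq_scale smul) M norm_M"
        by (intro complete_if_partial_sums_uniformly_bounded) auto
    qed
  qed (rule partial_sums_bound_iff_norm_equivalence)
qed

end
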